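(* Let $\mathbf{a}$ be a weak $m$-part composition of $n$ and let $t=(k,l)$ be a lattice point (with $0\le l\le m$) dominated by all cyclic shifts of $\mathbf{a}$. Then for every integer $c$, $$|\mathscr{G}_t(\mathbf{a})\cap\mathscr{C}^{c}| = m\binom{k}{c}\binom{l}{c}-n\binom{k-1}{c-1}\binom{l+1}{c+1}.$$
   Context: Lattice paths use unit steps $(0,1)$ (up) and $(1,0)$ (right). $\mathbf{a}=(a_0,\ldots,a_{m-1})$ is a tuple of nonnegative integers summing to $n$; indices read mod $m$. Let $f_{\mathbf{a}}(y)=a_r(y-r)+\sum_{j=0}^{r-1}a_j$ for $y\in[r,r+1]$, $0\le r<m$. A lattice point $(x,y)$ with $0\le y\le m$ is dominated by $\mathbf{a}$ if $x\ge f_{\mathbf{a}}(y)$; a path is dominated if all its lattice points are. Cyclic shifts: $\mathbf{a}^{j}=(a_{-j},\ldots,a_{-j+m-1})$. An LPBP is a pair $(P,(\mathbf{a},j))$ with $P$ a lattice path from the origin and $0\le j<m$; it is good if $P$ is dominated by $\mathbf{a}^j$. $\mathscr{G}_t(\mathbf{a})$ is the set of good LPBPs whose path ends at $t$. An up-right corner of a path is a point at which an up step ends and is immediately followed by a right step; $\mathscr{C}^{c}$ is the set of LPBPs whose path has exactly $c$ up-right corners. *)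

theory Defs
  imports Complex_Main
begin

text \<open>
  A lattice path starting at the origin is given by its list of steps; \<open>vertex P i\<close> is the
  lattice point reached after the first \<open>i\<close> steps.
\<close>

datatype step = Up | Right

type_synonym path = "step list"

definition vertex :: "path \<Rightarrow> nat \<Rightarrow> int \<times> int" where
  "vertex P i = (int (count_list (take i P) Right), int (count_list (take i P) Up))"

definition path_points :: "path \<Rightarrow> (int \<times> int) set" where
  "path_points P = vertex P ` {0..length P}"

definition path_end :: "path \<Rightarrow> int \<times> int" where
  "path_end P = vertex P (length P)"

definition up_right_corners :: "path \<Rightarrow> (int \<times> int) set" where
  "up_right_corners P =
     {vertex P (Suc i) | i. Suc i < length P \<and> P ! i = Up \<and> P ! Suc i = Right}"

definition weak_composition :: "nat \<Rightarrow> nat \<Rightarrow> nat list \<Rightarrow> bool" where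
  "weak_composition m n a \<longleftrightarrow> length a = m \<and> sum_list a = n"

text \<open>
  The boundary function is piecewise linear on \<open>[0, m]\<close>, with slope \<open>a\<^sub>r\<close> on \<open>[r, r + 1]\<close>. The
  minimum only matters at \<open>y = m\<close>, which belongs to the last piece. Values outside \<open>[0, m]\<close> carry
  no meaning and are never used.
\<close>

definition boundary :: "nat list \<Rightarrow> real \<Rightarrow> real" where
  "boundary a y =
     (let r = min (nat \<lfloor>y\<rfloor>) (length a - 1)
      in real (a ! r) * (y - real r) + (\<Sum>j<r. real (a ! j)))"

lemma boundary_eq:
  assumes "r < length a" and "real r \<le> y" and "y \<le> real r + 1"
  shows "boundary a y = real (a ! r) * (y - real r) + (\<Sum>j<r. real (a ! j))"
proof (cases "y = real r + 1")
  case True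
  then have y: "nat \<lfloor>y\<rfloor> = Suc r" by linarith
  show ?thesis
  proof (cases "Suc r < length a")
    case True
    then have "min (nat \<lfloor>y\<rfloor>) (length a - 1) = Suc r" using y by simp
    then show ?thesis using \<open>y = real r + 1\<close> by (simp add: boundary_def)
  next
    case False
    then have "min (nat \<lfloor>y\<rfloor>) (length a - 1) = r" using y assms(1) by simp
    then show ?thesis by (simp add: boundary_def)
  qed
next
  case False
  with assms have "nat \<lfloor>y\<rfloor> = r" by linarith
  with assms(1) have "min (nat \<lfloor>y\<rfloor>) (length a - 1) = r" by simp
  then show ?thesis by (simp add: boundary_def)
qed

definition point_dominated :: "nat list \<Rightarrow> int \<times> int \<Rightarrow> bool" where
  "point_dominated a p \<longleftrightarrow>
     0 \<le> snd p \<and> snd p \<le> int (length a) \<and> boundary a (of_int (snd p)) \<le> of_int (fst p)"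

definition path_dominated :: "nat list \<Rightarrow> path \<Rightarrow> bool" where
  "path_dominated a P \<longleftrightarrow> (\<forall>p\<in>path_points P. point_dominated a p)"

definition cyclic_shift :: "nat list \<Rightarrow> nat \<Rightarrow> nat list" where
  "cyclic_shift a j =
     map (\<lambda>i. a ! nat ((int i - int j) mod int (length a))) [0..<length a]"

type_synonym path_boundary_pair = "path \<times> (nat list \<times> nat)"

definition lpbps :: "path_boundary_pair set" where
  "lpbps = {(P, (a, j)). j < length a}"

definition good :: "path_boundary_pair \<Rightarrow> bool" where
  "good = (\<lambda>(P, (a, j)). path_dominated (cyclic_shift a j) P)"

definition good_lpbps :: "int \<times> int \<Rightarrow> nat list \<Rightarrow> path_boundary_pair set" where
  "good_lpbps t a = {(P, (b, j)) \<in> lpbps. b = a \<and> good (P, (b, j)) \<and> path_end P = t}"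

definition corner_lpbps :: "int \<Rightarrow> path_boundary_pair set" where
  "corner_lpbps c = {(P, (a, j)) \<in> lpbps. int (card (up_right_corners P)) = c}"

text \<open>
  Binomial coefficients with integer arguments: zero for a negative lower index (so in particular
  \<open>binom (-1) (-1) = 0\<close>), and the usual polynomial in the upper index otherwise.
  All values are integers; the result type is \<open>real\<close> because of the field sort constraint that
  \<open>Complex_Main\<close> leaves on \<open>gchoose\<close>.
\<close>

definition binom :: "int \<Rightarrow> int \<Rightarrow> real" where
  "binom x c = (if c < 0 then 0 else of_int x gchoose nat c)"

end

theory Submission
  imports Defs
begin

text \<open>
  A path with a given end is determined by its up-right corners, and it is dominated iff all its corners are, so a
  good path with \<open>c\<close> corners is a chain of \<open>c\<close> dominated points. Among all
  \<open>C(k, c) C(l, c)\<close> chains, a bad one is split at its first bad corner, whose column meets the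
  boundary at a certain unit horizontal step. The boundary of a cyclic shift is the same periodic staircase
  seen from another origin. Hence, over all \<open>m\<close> shifts, the bad chains can be grouped by that
  one of the \<open>n\<close> unit horizontal steps of the staircase in a period at which they are
  split. Measured backwards from that step, the good initial part of the chain, followed by the
  unrestricted rest, encodes an arbitrary choice of \<open>c - 1\<close> out of \<open>k - 1\<close> columns and
  \<open>c + 1\<close> out of \<open>l + 1\<close> rows: every step accounts for the same number of bad chains.
\<close>

section \<open>Counting chains of corners\<close>

text \<open>
  \<open>corner_chains s c k l\<close> is the number of sequences of \<open>c\<close> points, strictly increasing in both
  coordinates, in \<open>[0, k - 1] \<times> [1, l]\<close> with \<open>s y \<le> x\<close> for each point \<open>(x, y)\<close>. The recursion
  removes the last point \<open>(x, Suc h)\<close>.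
\<close>

fun corner_chains :: "(nat \<Rightarrow> nat) \<Rightarrow> nat \<Rightarrow> nat \<Rightarrow> nat \<Rightarrow> nat" where
  "corner_chains s 0 k l = 1"
| "corner_chains s (Suc c) k l = (\<Sum>h<l. \<Sum>x<k. if s (Suc h) \<le> x then corner_chains s c x h else 0)"

text \<open>Inclusion-exclusion over avoiding the last row or the last column: a chain that avoids
  neither ends at \<open>(k, Suc l)\<close>. Paths obey the same recurrence.\<close>

lemma chains_mixed_difference:
  "corner_chains s (Suc c) (Suc k) (Suc l) + corner_chains s (Suc c) k l =
   corner_chains s (Suc c) k (Suc l) + corner_chains s (Suc c) (Suc k) l
     + (if s (Suc l) \<le> k then corner_chains s c k l else 0)"
  by (simp add: sum.distrib)

text \<open>Hockey-stick summation: placing one more free row behind \<open>z\<close> raises the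
  lower index by one.\<close>

lemma sum_conv_choose:
  fixes f :: "nat \<Rightarrow> nat"
  shows "(\<Sum>h<l. \<Sum>z<Suc h. f z * ((h - z) choose e)) = (\<Sum>z<l. f z * ((l - z) choose Suc e))"
proof (induction l)
  case (Suc l)
  have "(\<Sum>z<l. f z * ((Suc l - z) choose Suc e)) =
      (\<Sum>z<l. f z * ((l - z) choose Suc e) + f z * ((l - z) choose e))"
    by (intro sum.cong) (auto simp: Suc_diff_le algebra_simps)
  moreover have "(Suc 0 choose Suc e) = (0 choose e)"
    by (cases e) auto
  ultimately show ?case using Suc by (simp add: sum.distrib del: binomial_Suc_Suc)
qed simp

text \<open>Column counterpart. Only columns beyond \<open>x\<close> remain, since the bad point
  already occupies \<open>x\<close>, whereas its row is still to be chosen.\<close>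

lemma sum_conv_choose_strict:
  fixes f :: "nat \<Rightarrow> nat"
  shows "(\<Sum>h<k. \<Sum>x<h. f x * ((h - 1 - x) choose e)) = (\<Sum>x<k. f x * ((k - 1 - x) choose Suc e))"
proof (induction k)
  case (Suc k)
  have "(\<Sum>x<k. f x * ((k - x) choose Suc e)) =
      (\<Sum>x<k. f x * ((k - 1 - x) choose Suc e) + f x * ((k - 1 - x) choose e))"
  proof (intro sum.cong refl)
    fix x assume "x \<in> {..<k}"
    then have "k - x = Suc (k - 1 - x)" by auto
    then show "f x * ((k - x) choose Suc e) =
        f x * ((k - 1 - x) choose Suc e) + f x * ((k - 1 - x) choose e)"
      by (simp add: algebra_simps)
  qed
  then show ?case using Suc by (simp add: sum.distrib)
qed simp

lemma sum_choose_lessThan: "(\<Sum>i<k. i choose c) = k choose Suc c"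
  by (induction k) auto

text \<open>By monotonicity, a column \<open>x\<close> short of the boundary at row
  \<open>Suc h\<close> crosses it at exactly one row \<open>Suc z\<close> with
  \<open>z \<le> h\<close>. Rows from \<open>Suc z\<close> to \<open>h\<close> hold no good point
  left of \<open>x\<close>, so the box shrinks to height \<open>z\<close>.\<close>

lemma chains_first_passage:
  fixes s :: "nat \<Rightarrow> nat"
  assumes "mono s" "s 0 = 0"
  shows "(if x < s (Suc h) then corner_chains s c x h else 0) =
    (\<Sum>z<Suc h. if s z \<le> x \<and> x < s (Suc z) then corner_chains s c x z else 0)"
proof (induction h)
  case 0
  then show ?case using assms by simp
next
  case (Suc h)
  have "corner_chains s c x (Suc h) = corner_chains s c x h" if "x < s (Suc h)"
  proof (cases c)
    case (Suc c')
    have "(\<Sum>x'<x. if s (Suc h) \<le> x' then corner_chains s c' x' h else 0) = 0"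
      using that by (intro sum.neutral) auto
    then show ?thesis using Suc by simp
  qed simp
  moreover have "s (Suc h) \<le> s (Suc (Suc h))" using assms(1) by (simp add: monoD)
  ultimately show ?case
    unfolding sum.lessThan_Suc[of _ "Suc h"] Suc.IH[symmetric] by auto
qed

text \<open>
  The \<open>d\<close> points before the first bad point of a chain lie below the crossing height \<open>Suc z\<close> of
  the column \<open>x\<close> of the bad point; the points after them are only restricted by
  their order.
\<close>

lemma choose_eq_chains_plus_bad:
  fixes s :: "nat \<Rightarrow> nat"
  assumes "mono s" "s 0 = 0"
  shows "(k choose c) * (l choose c) = corner_chains s c k l +
    (\<Sum>d<c. \<Sum>z<l. \<Sum>x<k. (if s z \<le> x \<and> x < s (Suc z) then corner_chains s d x z else 0)
        * ((l - z) choose (c - d)) * ((k - 1 - x) choose (c - 1 - d)))"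
proof (induction c arbitrary: k l)
  case 0
  then show ?case by simp
next
  case (Suc c)
  define f where "f d z x = (if s z \<le> x \<and> x < s (Suc z) then corner_chains s d x z else 0)" for d z x
  \<comment> \<open>The last point is \<open>(x, Suc h)\<close>; the induction hypothesis treats the
    points before it.\<close>
  have "(k choose Suc c) * (l choose Suc c) = (\<Sum>h<l. \<Sum>x<k. (x choose c) * (h choose c))"
    unfolding sum_choose_lessThan[symmetric] sum_product by (rule sum.swap)
  also have "\<dots> = (\<Sum>h<l. \<Sum>x<k. corner_chains s c x h) + (\<Sum>h<l. \<Sum>x'<k.
      (\<Sum>d<c. \<Sum>z<h. \<Sum>x<x'. f d z x * ((h - z) choose (c - d)) * ((x' - 1 - x) choose (c - 1 - d))))"
    unfolding Suc.IH f_def by (simp add: sum.distrib)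
  also have "(\<Sum>h<l. \<Sum>x<k. corner_chains s c x h) = corner_chains s (Suc c) k l
      + (\<Sum>h<l. \<Sum>x<k. if x < s (Suc h) then corner_chains s c x h else 0)"
    unfolding corner_chains.simps sum.distrib[symmetric] by (intro sum.cong) auto
  \<comment> \<open>Here the last point is the first bad one, which yields the summand
    \<open>d = c\<close>.\<close>
  also have "(\<Sum>h<l. \<Sum>x<k. if x < s (Suc h) then corner_chains s c x h else 0) =
      (\<Sum>h<l. \<Sum>x<k. \<Sum>z<Suc h. f c z x)"
    unfolding f_def chains_first_passage[OF assms] ..
  also have "\<dots> = (\<Sum>x<k. \<Sum>h<l. \<Sum>z<Suc h. f c z x * ((h - z) choose 0))"
    by (subst sum.swap) simp
  also have "\<dots> = (\<Sum>x<k. \<Sum>z<l. f c z x * ((l - z) choose Suc 0))"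
    by (simp only: sum_conv_choose)
  also have "\<dots> = (\<Sum>z<l. \<Sum>x<k. f c z x * ((l - z) choose (Suc c - c)) * ((k - 1 - x) choose (Suc c - 1 - c)))"
    by (subst sum.swap) simp
  \<comment> \<open>Here the first bad point comes earlier; the last point is a further free one and
    raises both lower indices.\<close>
  also have "(\<Sum>h<l. \<Sum>x'<k.
      (\<Sum>d<c. \<Sum>z<h. \<Sum>x<x'. f d z x * ((h - z) choose (c - d)) * ((x' - 1 - x) choose (c - 1 - d))))
      = (\<Sum>d<c. \<Sum>h<l. \<Sum>x'<k. \<Sum>z<h. \<Sum>x<x'.
          f d z x * ((h - z) choose (c - d)) * ((x' - 1 - x) choose (c - 1 - d)))"
    by (subst (2) sum.swap) (rule sum.swap)
  also have "\<dots> = (\<Sum>d<c. \<Sum>z<l. \<Sum>x<k. f d z x * ((l - z) choose (Suc c - d)) * ((k - 1 - x) choose (Suc c - 1 - d)))"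
  proof (rule sum.cong[OF refl])
    fix d assume "d \<in> {..<c}"
    then have d: "Suc c - d = Suc (c - d)" "Suc c - 1 - d = Suc (c - 1 - d)" "0 < c - d" by auto
    have "(\<Sum>h<l. \<Sum>x'<k. \<Sum>z<h. \<Sum>x<x'.
          f d z x * ((h - z) choose (c - d)) * ((x' - 1 - x) choose (c - 1 - d)))
        = (\<Sum>h<l. \<Sum>z<h. \<Sum>x'<k. \<Sum>x<x'.
          (f d z x * ((h - z) choose (c - d))) * ((x' - 1 - x) choose (c - 1 - d)))"
      by (subst (2) sum.swap) simp
    also have "\<dots> = (\<Sum>h<l. \<Sum>z<h. \<Sum>x<k.
        f d z x * ((h - z) choose (c - d)) * ((k - 1 - x) choose Suc (c - 1 - d)))"
      by (simp only: sum_conv_choose_strict)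
    \<comment> \<open>The added term \<open>z = h\<close> vanishes, since
      \<open>0 choose (c - d)\<close> is 0 for \<open>d < c\<close>.\<close>
    also have "\<dots> = (\<Sum>h<l. \<Sum>z<Suc h.
        (\<Sum>x<k. f d z x * ((k - 1 - x) choose Suc (c - 1 - d))) * ((h - z) choose (c - d)))"
      using d(3) by (intro sum.cong[OF refl]) (simp add: sum_distrib_left sum_distrib_right mult_ac)
    also have "\<dots> = (\<Sum>z<l. (\<Sum>x<k. f d z x * ((k - 1 - x) choose Suc (c - 1 - d)))
        * ((l - z) choose Suc (c - d)))"
      by (simp only: sum_conv_choose)
    finally show "(\<Sum>h<l. \<Sum>x'<k. \<Sum>z<h. \<Sum>x<x'.
          f d z x * ((h - z) choose (c - d)) * ((x' - 1 - x) choose (c - 1 - d))) =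
        (\<Sum>z<l. \<Sum>x<k. f d z x * ((l - z) choose (Suc c - d)) * ((k - 1 - x) choose (Suc c - 1 - d)))"
      unfolding d by (simp add: sum_distrib_left sum_distrib_right mult_ac del: binomial_Suc_Suc)
  qed
  finally show ?case unfolding f_def by (simp del: corner_chains.simps binomial_Suc_Suc)
qed

section \<open>Chains read from a crossing point\<close>

text \<open>
  A chain read backwards from the crossing point, in coordinates measured from there; \<open>Y h\<close>
  is the horizontal distance from the crossing point to the boundary \<open>h\<close> rows further down.
\<close>

fun rchains :: "(nat \<Rightarrow> nat) \<Rightarrow> nat \<Rightarrow> nat \<Rightarrow> nat \<Rightarrow> nat \<Rightarrow> nat" where
  "rchains Y 0 z p q = 1"
| "rchains Y (Suc d) z p q = (\<Sum>h=q..<z. \<Sum>x\<in>{p<..Y h}. rchains Y d z x (Suc h))"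

text \<open>Reflection in the crossing point sends column \<open>x\<close> to \<open>Y z - x\<close>
  and row \<open>h\<close> to \<open>z - h\<close>. The assumption on \<open>s\<close> turns
  \<open>s h \<le> x\<close> into \<open>Y z - x \<le> Y (z - h)\<close>.\<close>

lemma chains_eq_rchains:
  fixes s Y :: "nat \<Rightarrow> nat"
  assumes s: "\<And>h. h \<le> z \<Longrightarrow> s h + Y (z - h) = Y z"
    and "q \<le> z" "p \<le> Y z"
  shows "corner_chains s d (Y z - p) (z - q) = rchains Y d z p q"
  using assms(2,3)
proof (induction d arbitrary: p q)
  case 0
  then show ?case by simp
next
  case (Suc d)
  have flip: "z - Suc (z - Suc h) = h" if "h < z - q" for h using that by simp
  have "corner_chains s (Suc d) (Y z - p) (z - q) =
      (\<Sum>h=q..<z. \<Sum>x<Y z - p. if s (z - h) \<le> x then corner_chains s d x (z - Suc h) else 0)"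
    unfolding corner_chains.simps
    by (rule sum.reindex_bij_witness[where i="\<lambda>h. z - Suc h" and j="\<lambda>h. z - Suc h"])
      (use Suc.prems in \<open>auto simp: Suc_diff_Suc flip cong: if_cong\<close>)
  also have "\<dots> = (\<Sum>h=q..<z. \<Sum>x\<in>{p<..Y h}. rchains Y d z x (Suc h))"
  proof (rule sum.cong[OF refl])
    fix h assume h: "h \<in> {q..<z}"
    then have sz: "s (z - h) + Y h = Y z" using s[of "z - h"] by auto
    have "(\<Sum>x<Y z - p. if s (z - h) \<le> x then corner_chains s d x (z - Suc h) else 0) =
        (\<Sum>x\<in>{s (z - h)..<Y z - p}. corner_chains s d x (z - Suc h))"
      by (rule sum.mono_neutral_cong_right) auto
    also have "\<dots> = (\<Sum>x\<in>{p<..Y h}. corner_chains s d (Y z - x) (z - Suc h))"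
      by (rule sum.reindex_bij_witness[where i="\<lambda>x. Y z - x" and j="\<lambda>x. Y z - x"])
        (use sz in auto)
    also have "\<dots> = (\<Sum>x\<in>{p<..Y h}. rchains Y d z x (Suc h))"
      using h sz by (intro sum.cong refl Suc.IH) auto
    finally show "(\<Sum>x<Y z - p. if s (z - h) \<le> x then corner_chains s d x (z - Suc h) else 0) =
        (\<Sum>x\<in>{p<..Y h}. rchains Y d z x (Suc h))" .
  qed
  finally show ?case by simp
qed

text \<open>Hockey stick in \<open>i = l - z\<close>; including \<open>i = 0\<close> is harmless
  because \<open>0 choose Suc e\<close> is 0.\<close>

lemma sum_choose_diff: "(\<Sum>z=q..<l. (l - z) choose Suc e) = (Suc l - q) choose Suc (Suc e)"
proof (cases "q \<le> l")
  case True
  have "(\<Sum>z=q..<l. (l - z) choose Suc e) = (\<Sum>i<Suc l - q. i choose Suc e)"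
    unfolding sum.lessThan_Suc_shift Suc_diff_le[OF True]
    by (simp del: binomial_Suc_Suc) (rule sum.reindex_bij_witness[where i="\<lambda>i. l - Suc i" and j="\<lambda>i. l - Suc i"],
      auto simp: Suc_diff_Suc simp del: binomial_Suc_Suc)
  then show ?thesis by (simp only: sum_choose_lessThan)
qed simp

text \<open>Among \<open>Suc e\<close> columns chosen from \<open>{p<..K}\<close>, either all lie
  beyond \<open>b\<close>, or the smallest is some \<open>x \<le> b\<close>.\<close>

lemma sum_choose_greaterThanAtMost:
  assumes "p \<le> b" "b \<le> K"
  shows "(K - b choose Suc e) + (\<Sum>x\<in>{p<..b}. (K - x) choose e) = (K - p) choose Suc e"
  using assms
proof (induction b rule: dec_induct)
  case (step b)
  have "{p<..Suc b} = insert (Suc b) {p<..b}" using step by auto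
  moreover have "K - b = Suc (K - Suc b)" using step by auto
  ultimately show ?case using step by simp
qed simp

text \<open>
  The right-hand side counts choices of \<open>e\<close> columns and \<open>e + 2\<close> rows. The columns are paired with
  the first rows; the first row whose column lies beyond the boundary is the row \<open>z\<close> of
  the left-hand side, preceded by \<open>d\<close> good pairs.
\<close>

lemma sum_rchains:
  fixes Y :: "nat \<Rightarrow> nat"
  assumes "mono Y" "\<And>z. q \<le> z \<Longrightarrow> z < l \<Longrightarrow> p \<le> Y z \<and> Y z \<le> K"
  shows "(\<Sum>d\<le>e. \<Sum>z=q..<l. rchains Y d z p q * ((l - z) choose Suc (e - d)) * ((K - Y z) choose (e - d)))
    = ((Suc l - q) choose Suc (Suc e)) * ((K - p) choose e)"
  using assms(2)
proof (induction e arbitrary: p q)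
  case 0
  then show ?case using sum_choose_diff[of l 0 q] by simp
next
  case (Suc e)
  \<comment> \<open>For \<open>d = 0\<close> the first column is already beyond the boundary;
    otherwise unfolding \<open>rchains\<close> exposes the first good pair, column \<open>x\<close>
    and row \<open>h\<close>.\<close>
  have "(\<Sum>d\<le>Suc e. \<Sum>z=q..<l. rchains Y d z p q * ((l - z) choose Suc (Suc e - d)) * ((K - Y z) choose (Suc e - d)))
    = (\<Sum>z=q..<l. ((l - z) choose Suc (Suc e)) * ((K - Y z) choose Suc e)) +
      (\<Sum>d\<le>e. \<Sum>z=q..<l. (\<Sum>h=q..<z. \<Sum>x\<in>{p<..Y h}. rchains Y d z x (Suc h))
         * ((l - z) choose Suc (e - d)) * ((K - Y z) choose (e - d)))"
    by (subst sum.atMost_Suc_shift) (simp del: binomial_Suc_Suc)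
  also have "(\<Sum>d\<le>e. \<Sum>z=q..<l. (\<Sum>h=q..<z. \<Sum>x\<in>{p<..Y h}. rchains Y d z x (Suc h))
         * ((l - z) choose Suc (e - d)) * ((K - Y z) choose (e - d)))
    = (\<Sum>d\<le>e. \<Sum>z=q..<l. \<Sum>h=q..<z. \<Sum>x\<in>{p<..Y h}. rchains Y d z x (Suc h)
         * ((l - z) choose Suc (e - d)) * ((K - Y z) choose (e - d)))"
    by (simp only: sum_distrib_right)
  also have "\<dots> = (\<Sum>d\<le>e. \<Sum>h=q..<l. \<Sum>z=Suc h..<l. \<Sum>x\<in>{p<..Y h}. rchains Y d z x (Suc h)
         * ((l - z) choose Suc (e - d)) * ((K - Y z) choose (e - d)))"
  proof -
    have "(\<Sum>z=q..<l. \<Sum>h=q..<z. g z h) = (\<Sum>h=q..<l. \<Sum>z=Suc h..<l. g z h)"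
      for g :: "nat \<Rightarrow> nat \<Rightarrow> nat"
      unfolding sum.Sigma[OF finite_atLeastLessThan ballI, OF finite_atLeastLessThan]
      by (rule sum.reindex_bij_witness[where i="\<lambda>(x, y). (y, x)" and j="\<lambda>(x, y). (y, x)"]) auto
    then show ?thesis by simp
  qed
  also have "\<dots> = (\<Sum>d\<le>e. \<Sum>h=q..<l. \<Sum>x\<in>{p<..Y h}. \<Sum>z=Suc h..<l. rchains Y d z x (Suc h)
         * ((l - z) choose Suc (e - d)) * ((K - Y z) choose (e - d)))"
    by (intro sum.cong refl sum.swap)
  also have "\<dots> = (\<Sum>h=q..<l. \<Sum>x\<in>{p<..Y h}. \<Sum>d\<le>e. \<Sum>z=Suc h..<l. rchains Y d z x (Suc h)
         * ((l - z) choose Suc (e - d)) * ((K - Y z) choose (e - d)))"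
    by (subst sum.swap) (intro sum.cong refl sum.swap)
  also have "\<dots> = (\<Sum>h=q..<l. \<Sum>x\<in>{p<..Y h}. ((l - h) choose Suc (Suc e)) * ((K - x) choose e))"
  proof (intro sum.cong refl)
    fix h x assume hx: "h \<in> {q..<l}" "x \<in> {p<..Y h}"
    \<comment> \<open>Behind that pair the same problem remains, with \<open>p\<close> and
      \<open>q\<close> moved to \<open>x\<close> and \<open>Suc h\<close>.\<close>
    have "(\<Sum>d\<le>e. \<Sum>z=Suc h..<l. rchains Y d z x (Suc h)
         * ((l - z) choose Suc (e - d)) * ((K - Y z) choose (e - d)))
        = ((Suc l - Suc h) choose Suc (Suc e)) * ((K - x) choose e)"
    proof (rule Suc.IH)
      fix z assume "Suc h \<le> z" "z < l"
      then show "x \<le> Y z \<and> Y z \<le> K"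
        using hx Suc.prems[of z] monoD[OF \<open>mono Y\<close>, of h z] by auto
    qed
    then show "(\<Sum>d\<le>e. \<Sum>z=Suc h..<l. rchains Y d z x (Suc h)
         * ((l - z) choose Suc (e - d)) * ((K - Y z) choose (e - d)))
        = ((l - h) choose Suc (Suc e)) * ((K - x) choose e)" by (simp del: binomial_Suc_Suc)
  qed
  also have "(\<Sum>z=q..<l. ((l - z) choose Suc (Suc e)) * ((K - Y z) choose Suc e)) + \<dots> =
    (\<Sum>h=q..<l. ((l - h) choose Suc (Suc e))
        * (((K - Y h) choose Suc e) + (\<Sum>x\<in>{p<..Y h}. (K - x) choose e)))"
    by (simp add: sum.distrib sum_distrib_left distrib_left del: binomial_Suc_Suc)
  also have "\<dots> = (\<Sum>h=q..<l. ((l - h) choose Suc (Suc e)) * ((K - p) choose Suc e))"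
    using Suc.prems by (intro sum.cong refl arg_cong2[where f="(*)"] sum_choose_greaterThanAtMost) auto
  also have "\<dots> = ((Suc l - q) choose Suc (Suc (Suc e))) * ((K - p) choose Suc e)"
    unfolding sum_distrib_right[symmetric] sum_choose_diff ..
  finally show ?case .
qed

section \<open>Summing over the cyclic shifts\<close>

text \<open>With \<open>A\<close> the periodic extension of \<open>a\<close>, origin
  \<open>b = - j\<close> gives the boundary of the shift by \<open>j\<close> at integer heights. All
  shifts thus share one bi-infinite staircase.\<close>

definition psum :: "(int \<Rightarrow> nat) \<Rightarrow> int \<Rightarrow> nat \<Rightarrow> nat" where
  "psum A b h = (\<Sum>i<h. A (b + int i))"

lemma psum_0 [simp]: "psum A b 0 = 0"
  by (simp add: psum_def)

lemma psum_Suc [simp]: "psum A b (Suc h) = psum A b h + A (b + int h)"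
  by (simp add: psum_def)

lemma psum_add: "psum A b (h + i) = psum A b h + psum A (b + int h) i"
  by (induction i) (auto simp: algebra_simps)

lemma mono_psum: "mono (psum A b)"
  by (rule monoI) (auto simp: psum_def intro: sum_mono2)

lemma psum_periodic:
  assumes "\<And>i. A (i mod int m) = A i"
  shows "psum A (b mod int m) = psum A b"
proof
  fix h
  have "A (b mod int m + int i) = A (b + int i)" for i
    using assms[of "b mod int m + int i"] assms[of "b + int i"] by (simp add: mod_add_left_eq)
  then show "psum A (b mod int m) h = psum A b h" by (simp add: psum_def)
qed

text \<open>The mark, unit step \<open>o'\<close> of row \<open>r\<close>, stays fixed while the
  origin \<open>r - z\<close> moves. The distance \<open>Y z\<close> from the origin to the mark
  satisfies the splitting law of \<open>chains_eq_rchains\<close>, so \<open>sum_rchains\<close>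
  gives a value independent of the mark.\<close>

lemma sum_chains_at_mark:
  fixes A :: "int \<Rightarrow> nat"
  assumes "o' < A r" "\<And>b. psum A b l \<le> k"
  shows "(\<Sum>d<Suc e. \<Sum>z<l. corner_chains (psum A (r - int z)) d (psum A (r - int z) z + o') z
      * ((l - z) choose (Suc e - d)) * ((k - 1 - (psum A (r - int z) z + o')) choose (e - d)))
    = (Suc l choose Suc (Suc e)) * ((k - 1) choose e)"
proof -
  define Y where "Y z = psum A (r - int z) z + o'" for z
  have Y_split: "psum A (r - int z) h + Y (z - h) = Y z" if "h \<le> z" for h z
  proof -
    have "r - int (z - h) = r - int z + int h" using that by simp
    then show ?thesis using psum_add[of A "r - int z" h "z - h"] that by (simp only: Y_def) simp
  qed
  have "mono Y"
    by (rule monoI) (metis Y_split diff_diff_cancel diff_le_self le_add2)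
  \<comment> \<open>Domination of the end point by all shifts enters here: the mark lies strictly
    before the end of its row, hence before column \<open>k\<close>.\<close>
  have Y_less: "Y z \<le> k - 1" if "z < l" for z
  proof -
    have "Y z < psum A (r - int z) (Suc z)" using assms(1) by (simp add: Y_def)
    also have "\<dots> \<le> psum A (r - int z) l" using that by (intro monoD[OF mono_psum]) auto
    also have "\<dots> \<le> k" by (rule assms(2))
    finally show ?thesis by simp
  qed
  have "corner_chains (psum A (r - int z)) d (Y z) z = rchains Y d z 0 0" for d z
    using chains_eq_rchains[of z "psum A (r - int z)" Y 0 0 d] Y_split by simp
  moreover have "(\<Sum>d\<le>e. \<Sum>z=0..<l. rchains Y d z 0 0 * ((l - z) choose Suc (e - d)) * ((k - 1 - Y z) choose (e - d)))
    = ((Suc l - 0) choose Suc (Suc e)) * ((k - 1 - 0) choose e)"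
    using \<open>mono Y\<close> Y_less by (intro sum_rchains) auto
  ultimately show ?thesis
    unfolding Y_def[symmetric]
    by (simp add: lessThan_Suc_atMost atLeast0LessThan Suc_diff_le del: binomial_Suc_Suc)
qed

text \<open>For fixed \<open>z\<close>, both \<open>- j\<close> and \<open>r - z\<close> run once
  through the residues modulo \<open>m\<close>. The new variable \<open>r\<close> is the row of the
  staircase containing the crossing.\<close>

lemma sum_over_shifts:
  fixes g :: "int \<Rightarrow> nat"
  assumes "m > 0" "\<And>b. g (b mod int m) = g b"
  shows "(\<Sum>j<m. g (- int j)) = (\<Sum>r<m. g (int r - int z))"
proof (rule sum.reindex_bij_witness[where i="\<lambda>r. nat ((int z - int r) mod int m)"
      and j="\<lambda>j. nat ((int z - int j) mod int m)"])
  show "g (int (nat ((int z - int j) mod int m)) - int z) = g (- int j)" for j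
    using assms assms(2)[of "(int z - int j) mod int m - int z"] assms(2)[of "- int j"]
    by (simp add: mod_diff_left_eq)
qed (use assms(1) in \<open>auto simp: mod_diff_right_eq nat_less_iff\<close>)

lemma sum_restrict_interval:
  fixes g :: "nat \<Rightarrow> nat"
  assumes "b + w \<le> k"
  shows "(\<Sum>x<k. if b \<le> x \<and> x < b + w then g x else 0) = (\<Sum>i<w. g (b + i))"
proof -
  have "(\<Sum>x<k. if b \<le> x \<and> x < b + w then g x else 0) = (\<Sum>x\<in>{b..<b + w}. g x)"
    using assms by (intro sum.mono_neutral_cong_right) auto
  also have "\<dots> = (\<Sum>i<w. g (b + i))"
    by (rule sum.reindex_bij_witness[where i="\<lambda>i. b + i" and j="\<lambda>x. x - b"]) auto
  finally show ?thesis .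
qed

text \<open>
  A crossing point of the boundary of some shift is a row \<open>r\<close> of \<open>a\<close> together with an offset
  \<open>o' < a\<^sub>r\<close>, so there are \<open>n\<close> marks, each contributing the same number of bad chains.
\<close>

lemma sum_chains_shifts:
  fixes A :: "int \<Rightarrow> nat"
  assumes "m > 0" and periodic: "\<And>i. A (i mod int m) = A i"
    and bound: "\<And>b. psum A b l \<le> k"
  shows "(\<Sum>j<m. corner_chains (psum A (- int j)) (Suc e) k l)
      + (\<Sum>r<m. A (int r)) * ((k - 1) choose e) * (Suc l choose Suc (Suc e))
    = m * (k choose Suc e) * (l choose Suc e)"
proof -
  define W where "W d z x = ((l - z) choose (Suc e - d)) * ((k - 1 - x) choose (e - d))" for d z x
  define F where "F b d z x = corner_chains (psum A b) d x z * W d z x" for b d z x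
  have "m * (k choose Suc e) * (l choose Suc e) = (\<Sum>j<m. (k choose Suc e) * (l choose Suc e))"
    by simp
  also have "\<dots> = (\<Sum>j<m. corner_chains (psum A (- int j)) (Suc e) k l + (\<Sum>d<Suc e. \<Sum>z<l. \<Sum>x<k.
      (if psum A (- int j) z \<le> x \<and> x < psum A (- int j) (Suc z) then corner_chains (psum A (- int j)) d x z else 0)
        * ((l - z) choose (Suc e - d)) * ((k - 1 - x) choose (Suc e - 1 - d))))"
    by (intro sum.cong refl choose_eq_chains_plus_bad mono_psum psum_0)
  also have "\<dots> = (\<Sum>j<m. corner_chains (psum A (- int j)) (Suc e) k l + (\<Sum>d<Suc e. \<Sum>z<l. \<Sum>x<k.
      if psum A (- int j) z \<le> x \<and> x < psum A (- int j) z + A (- int j + int z) then F (- int j) d z x else 0))"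
    unfolding F_def W_def psum_Suc diff_Suc_1
    by (intro sum.cong refl arg_cong2[where f="(+)"]) (auto simp del: binomial_Suc_Suc)
  also have "\<dots> = (\<Sum>j<m. corner_chains (psum A (- int j)) (Suc e) k l) + (\<Sum>j<m. \<Sum>d<Suc e. \<Sum>z<l.
      \<Sum>i<A (- int j + int z). F (- int j) d z (psum A (- int j) z + i))"
  proof -
    \<comment> \<open>All unit steps of this row lie in the columns below \<open>k\<close>, so no
      mark is cut off.\<close>
    have "psum A (- int j) z + A (- int j + int z) \<le> k" if "z \<in> {..<l}" for j z
    proof -
      have "psum A (- int j) (Suc z) \<le> psum A (- int j) l"
        using that by (intro monoD[OF mono_psum]) auto
      then show ?thesis using bound[of "- int j"] by simp
    qed
    note restrict = sum_restrict_interval[OF this]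
    show ?thesis
      unfolding sum.distrib
      by (rule arg_cong2[where f="(+)", OF refl], rule sum.cong[OF refl], rule sum.cong[OF refl],
          rule sum.cong[OF refl], erule restrict)
  qed
  also have "(\<Sum>j<m. \<Sum>d<Suc e. \<Sum>z<l.
      \<Sum>i<A (- int j + int z). F (- int j) d z (psum A (- int j) z + i)) =
      (\<Sum>d<Suc e. \<Sum>z<l. \<Sum>j<m.
      \<Sum>i<A (- int j + int z). F (- int j) d z (psum A (- int j) z + i))"
    by (subst sum.swap) (intro sum.cong refl sum.swap)
  also have "\<dots> = (\<Sum>d<Suc e. \<Sum>z<l. \<Sum>r<m.
      \<Sum>i<A (int r - int z + int z). F (int r - int z) d z (psum A (int r - int z) z + i))"
  proof (rule sum.cong[OF refl], rule sum.cong[OF refl],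
      rule sum_over_shifts[where g="\<lambda>b. \<Sum>i<A (b + int _). F b _ _ (psum A b _ + i)", OF \<open>m > 0\<close>])
    fix d z b
    have "A (b mod int m + int z) = A (b + int z)"
      using periodic[of "b mod int m + int z"] periodic[of "b + int z"] by (simp add: mod_add_left_eq)
    then show "(\<Sum>i<A (b mod int m + int z). F (b mod int m) d z (psum A (b mod int m) z + i))
        = (\<Sum>i<A (b + int z). F b d z (psum A b z + i))"
      unfolding F_def psum_periodic[where A=A and m=m, OF periodic] by simp
  qed
  also have "\<dots> = (\<Sum>r<m. \<Sum>i<A (int r). \<Sum>d<Suc e. \<Sum>z<l.
      F (int r - int z) d z (psum A (int r - int z) z + i))"
  proof -
    have "(\<Sum>d<Suc e. \<Sum>z<l. \<Sum>r<m. \<Sum>i<A (int r). G d z r i) =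
        (\<Sum>r<m. \<Sum>i<A (int r). \<Sum>d<Suc e. \<Sum>z<l. G d z r i)" for G :: "nat \<Rightarrow> nat \<Rightarrow> nat \<Rightarrow> nat \<Rightarrow> nat"
    proof -
      have "(\<Sum>d<Suc e. \<Sum>z<l. \<Sum>r<m. \<Sum>i<A (int r). G d z r i) =
          (\<Sum>d<Suc e. \<Sum>r<m. \<Sum>i<A (int r). \<Sum>z<l. G d z r i)"
      proof (rule sum.cong[OF refl])
        fix d
        have "(\<Sum>z<l. \<Sum>r<m. \<Sum>i<A (int r). G d z r i) = (\<Sum>r<m. \<Sum>z<l. \<Sum>i<A (int r). G d z r i)"
          by (rule sum.swap)
        also have "\<dots> = (\<Sum>r<m. \<Sum>i<A (int r). \<Sum>z<l. G d z r i)"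
          by (rule sum.cong[OF refl], rule sum.swap)
        finally show "(\<Sum>z<l. \<Sum>r<m. \<Sum>i<A (int r). G d z r i) =
            (\<Sum>r<m. \<Sum>i<A (int r). \<Sum>z<l. G d z r i)" .
      qed
      also have "\<dots> = (\<Sum>r<m. \<Sum>d<Suc e. \<Sum>i<A (int r). \<Sum>z<l. G d z r i)"
        by (rule sum.swap)
      also have "\<dots> = (\<Sum>r<m. \<Sum>i<A (int r). \<Sum>d<Suc e. \<Sum>z<l. G d z r i)"
        by (intro sum.cong refl sum.swap)
      finally show ?thesis .
    qed
    then show ?thesis by simp
  qed
  also have "\<dots> = (\<Sum>r<m. \<Sum>i<A (int r). (Suc l choose Suc (Suc e)) * ((k - 1) choose e))"
  proof (intro sum.cong refl)
    fix r i assume "i \<in> {..<A (int r)}"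
    then show "(\<Sum>d<Suc e. \<Sum>z<l. F (int r - int z) d z (psum A (int r - int z) z + i))
        = (Suc l choose Suc (Suc e)) * ((k - 1) choose e)"
      unfolding F_def W_def mult.assoc[symmetric] using bound by (intro sum_chains_at_mark) auto
  qed
  finally show ?thesis by (simp add: sum_distrib_left sum_distrib_right mult_ac del: binomial_Suc_Suc corner_chains.simps)
qed

section \<open>Paths and their corners\<close>

lemma path_end_eq: "path_end P = (int (count_list P Right), int (count_list P Up))"
  by (simp add: path_end_def vertex_def)

lemma vertex_append: "i \<le> length P \<Longrightarrow> vertex (P @ Q) i = vertex P i"
  by (simp add: vertex_def)

lemma path_points_Nil: "path_points [] = {(0, 0)}"
  by (simp add: path_points_def vertex_def)

lemma path_points_snoc: "path_points (P @ [s]) = insert (path_end (P @ [s])) (path_points P)"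
proof -
  have "{0..length (P @ [s])} = insert (length (P @ [s])) {0..length P}" by auto
  then show ?thesis
    by (auto simp: path_points_def path_end_def vertex_append image_iff)
qed

lemma up_right_corners_Nil [simp]: "up_right_corners [] = {}"
  by (simp add: up_right_corners_def)

lemma up_right_corners_snoc:
  "up_right_corners (P @ [s]) =
    (if s = Right \<and> P \<noteq> [] \<and> last P = Up then insert (path_end P) (up_right_corners P)
     else up_right_corners P)" (is "?L = ?R")
proof -
  have old: "vertex (P @ [s]) (Suc i) = vertex P (Suc i)" "(P @ [s]) ! i = P ! i"
    "(P @ [s]) ! Suc i = P ! Suc i" if "Suc i < length P" for i
    using that by (auto simp: nth_append vertex_append)
  have new: "vertex (P @ [s]) (Suc i) = path_end P" "(P @ [s]) ! i = last P"
    "(P @ [s]) ! Suc i = s" if "Suc i = length P" for i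
  proof -
    have i: "i = length P - 1" "P \<noteq> []" using that by auto
    show "vertex (P @ [s]) (Suc i) = path_end P" using that
      by (simp add: path_end_def vertex_append)
    show "(P @ [s]) ! i = last P" using i by (simp add: nth_append last_conv_nth)
    show "(P @ [s]) ! Suc i = s" using that by (simp add: nth_append)
  qed
  have L: "p \<in> ?L \<longleftrightarrow> (\<exists>i. (Suc i < length P \<or> Suc i = length P) \<and> (P @ [s]) ! i = Up
      \<and> (P @ [s]) ! Suc i = Right \<and> p = vertex (P @ [s]) (Suc i))" for p
    by (auto simp: up_right_corners_def less_Suc_eq)
  have P: "p \<in> up_right_corners P \<longleftrightarrow> (\<exists>i. Suc i < length P \<and> (P @ [s]) ! i = Up
      \<and> (P @ [s]) ! Suc i = Right \<and> p = vertex (P @ [s]) (Suc i))" for p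
    unfolding up_right_corners_def using old by auto
  have "p \<in> ?L \<longleftrightarrow> p \<in> up_right_corners P \<or> P \<noteq> [] \<and> last P = Up \<and> s = Right \<and> p = path_end P" for p
  proof (cases "P = []")
    case False
    then obtain i where i: "Suc i = length P" by (cases P) auto
    then have "Suc i' = length P \<longleftrightarrow> i' = i" for i' by auto
    then show ?thesis unfolding L P using new[OF i] False by auto
  qed (simp add: L up_right_corners_def)
  then show ?thesis by auto
qed

lemma finite_up_right_corners [simp]: "finite (up_right_corners P)"
  by (induction P rule: rev_induct) (auto simp: up_right_corners_snoc)

lemma up_right_corners_less: "p \<in> up_right_corners P \<Longrightarrow> fst p < int (count_list P Right)"
  by (induction P rule: rev_induct)
    (auto simp: up_right_corners_snoc path_end_eq split: if_splits)

lemma path_end_notin_up_right_corners: "path_end P \<notin> up_right_corners P"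
  using up_right_corners_less[of "path_end P" P] by (auto simp: path_end_eq)

lemma up_right_corners_subset: "up_right_corners P \<subseteq> path_points P"
  by (auto simp: up_right_corners_def path_points_def)

lemma path_points_bounds:
  "p \<in> path_points P \<Longrightarrow> 0 \<le> fst p \<and> 0 \<le> snd p \<and> snd p \<le> int (count_list P Up)"
  by (induction P rule: rev_induct)
    (auto simp: path_points_Nil path_points_snoc path_end_eq)

text \<open>The vertical run on which the path first attains height \<open>snd p\<close> ends in a
  corner weakly left of and above \<open>p\<close>, unless it is the final run. This reduces
  domination to the corners and the end.\<close>

lemma path_point_behind_corner:
  assumes "p \<in> path_points P"
  shows "snd p = 0 \<or> (\<exists>q\<in>up_right_corners P. fst q \<le> fst p \<and> snd p \<le> snd q) \<or>
    (P \<noteq> [] \<and> last P = Up \<and> fst p = int (count_list P Right))"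
  using assms
proof (induction P arbitrary: p rule: rev_induct)
  case Nil
  then show ?case by (simp add: path_points_Nil)
next
  case (snoc s P)
  have old: "snd p = 0 \<or> (\<exists>q\<in>up_right_corners (P @ [s]). fst q \<le> fst p \<and> snd p \<le> snd q) \<or>
      (s = Up \<and> fst p = int (count_list P Right))" if "p \<in> path_points P" for p
  proof (cases s)
    case Up
    then show ?thesis using snoc.IH[OF that] by (auto simp: up_right_corners_snoc)
  next
    case Right
    \<comment> \<open>If \<open>P\<close> ends in a vertical run, the new step makes its top a
      corner, which absorbs the third alternative.\<close>
    then show ?thesis using snoc.IH[OF that] path_points_bounds[OF that]
      by (auto simp: up_right_corners_snoc path_end_eq)
  qed
  show ?case
  proof (cases "p \<in> path_points P")
    case True
    then show ?thesis using old[OF True] by auto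
  next
    case False
    then have p: "p = path_end (P @ [s])" using snoc.prems by (simp add: path_points_snoc)
    show ?thesis
    proof (cases s)
      case Up
      then show ?thesis using p by (simp add: path_end_eq)
    next
      case Right
      have "path_end P \<in> path_points P" by (simp add: path_end_def path_points_def)
      from old[OF this] show ?thesis using p Right by (force simp: path_end_eq)
    qed
  qed
qed

section \<open>Paths as chains of corners\<close>

text \<open>Domination is imposed at corners only; \<open>path_dominated_cyclic_shift\<close>
  justifies this.\<close>

definition corner_paths :: "(nat \<Rightarrow> nat) \<Rightarrow> nat \<Rightarrow> nat \<Rightarrow> nat \<Rightarrow> path set" where
  "corner_paths s c k l = {P. count_list P Right = k \<and> count_list P Up = l \<and>
     card (up_right_corners P) = c \<and> (\<forall>q\<in>up_right_corners P. int (s (nat (snd q))) \<le> fst q)}"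

lemma length_eq_count_list: "length P = count_list P Right + count_list P Up"
proof (induction P)
  case (Cons s P)
  then show ?case by (cases s) auto
qed simp

lemma finite_corner_paths [simp]: "finite (corner_paths s c k l)"
proof -
  have "s \<in> {Up, Right}" for s by (cases s) auto
  then have "corner_paths s c k l \<subseteq> {P. set P \<subseteq> {Up, Right} \<and> length P = k + l}"
    by (auto simp: corner_paths_def length_eq_count_list)
  then show ?thesis
    by (rule finite_subset) (intro finite_lists_length_eq, simp)
qed

lemma Nil_in_corner_paths: "[] \<in> corner_paths s c k l \<longleftrightarrow> c = 0 \<and> k = 0 \<and> l = 0"
  by (auto simp: corner_paths_def)

lemma snoc_Up_in_corner_paths:
  "P @ [Up] \<in> corner_paths s c k l \<longleftrightarrow> (\<exists>l'. l = Suc l' \<and> P \<in> corner_paths s c k l')"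
  by (auto simp: corner_paths_def up_right_corners_snoc)

lemma snoc_Right_in_corner_paths:
  assumes "P = [] \<or> last P = Right"
  shows "P @ [Right] \<in> corner_paths s c k l \<longleftrightarrow> (\<exists>k'. k = Suc k' \<and> P \<in> corner_paths s c k' l)"
  using assms by (auto simp: corner_paths_def up_right_corners_snoc)

lemma snoc_Up_Right_in_corner_paths:
  "P @ [Up, Right] \<in> corner_paths s c k l \<longleftrightarrow>
    (\<exists>c' k' l'. c = Suc c' \<and> k = Suc k' \<and> l = Suc l' \<and> s l \<le> k' \<and> P \<in> corner_paths s c' k' l')"
proof -
  have "up_right_corners (P @ [Up, Right]) = insert (path_end (P @ [Up])) (up_right_corners (P @ [Up]))"
    using up_right_corners_snoc[of "P @ [Up]" Right] by simp
  moreover have "path_end (P @ [Up]) \<notin> up_right_corners (P @ [Up])"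
    by (rule path_end_notin_up_right_corners)
  ultimately show ?thesis
    by (auto simp: corner_paths_def up_right_corners_snoc path_end_eq nat_add_distrib)
qed

text \<open>\<open>Up\<close> followed by \<open>Right\<close> is removed as a unit, so that each
  case changes the number of corners by a known amount.\<close>

lemma path_snoc_cases:
  obtains "P = []" | Q where "P = Q @ [Up]" | Q where "P = Q @ [Right]" "Q = [] \<or> last Q = Right"
    | Q where "P = Q @ [Up, Right]"
proof (cases P rule: rev_cases)
  case (snoc Q s)
  show ?thesis
  proof (cases s)
    case Right
    show ?thesis
    proof (cases Q rule: rev_cases)
      case (snoc Q' s')
      then show ?thesis using that \<open>P = Q @ [s]\<close> Right by (cases s') auto
    qed (use that snoc Right in auto)
  qed (use that snoc in auto)
qed (use that in auto)

lemma corner_paths_no_Right: "corner_paths s c 0 l = (if c = 0 then {replicate l Up} else {})"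
proof (induction l)
  case 0
  have "P \<in> corner_paths s c 0 0 \<longleftrightarrow> P = [] \<and> c = 0" for P
    by (cases P rule: path_snoc_cases)
      (auto simp: Nil_in_corner_paths snoc_Up_in_corner_paths snoc_Right_in_corner_paths
        snoc_Up_Right_in_corner_paths)
  then show ?case by auto
next
  case (Suc l)
  have "P \<in> corner_paths s c 0 (Suc l) \<longleftrightarrow> (\<exists>Q. P = Q @ [Up] \<and> Q \<in> corner_paths s c 0 l)" for P
    by (cases P rule: path_snoc_cases)
      (auto simp: Nil_in_corner_paths snoc_Up_in_corner_paths snoc_Right_in_corner_paths
        snoc_Up_Right_in_corner_paths)
  then show ?case using Suc by (auto simp: replicate_append_same split: if_splits)
qed

lemma corner_paths_no_Up: "corner_paths s c k 0 = (if c = 0 then {replicate k Right} else {})"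
proof (induction k)
  case 0
  show ?case by (simp add: corner_paths_no_Right)
next
  case (Suc k)
  have "replicate k Right = [] \<or> last (replicate k Right) = Right" by (cases "k = 0") auto
  moreover have "P \<in> corner_paths s c (Suc k) 0 \<longleftrightarrow>
      (\<exists>Q. P = Q @ [Right] \<and> (Q = [] \<or> last Q = Right) \<and> Q \<in> corner_paths s c k 0)" for P
    by (cases P rule: path_snoc_cases)
      (auto simp: Nil_in_corner_paths snoc_Up_in_corner_paths snoc_Right_in_corner_paths
        snoc_Up_Right_in_corner_paths)
  ultimately show ?case using Suc by (auto simp: replicate_append_same split: if_splits)
qed

text \<open>A path ends in \<open>Up\<close>, in a \<open>Right\<close> that closes no corner, or in
  a corner followed by one \<open>Right\<close>. These cases mirror
  \<open>chains_mixed_difference\<close>.\<close>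

lemma card_corner_paths_mixed_difference:
  "card (corner_paths s c (Suc k) (Suc l)) + card (corner_paths s c k l) =
   card (corner_paths s c k (Suc l)) + card (corner_paths s c (Suc k) l)
     + (case c of 0 \<Rightarrow> 0 | Suc c' \<Rightarrow> if s (Suc l) \<le> k then card (corner_paths s c' k l) else 0)"
proof -
  define D where "D = (case c of 0 \<Rightarrow> {} | Suc c' \<Rightarrow> if s (Suc l) \<le> k then corner_paths s c' k l else {})"
  define R where "R = {P \<in> corner_paths s c k (Suc l). P = [] \<or> last P = Right}"
  have fin: "finite D" "finite R" by (auto simp: D_def R_def split: nat.split)
  have "P \<in> corner_paths s c (Suc k) (Suc l) \<longleftrightarrow>
      P \<in> (\<lambda>P. P @ [Up]) ` corner_paths s c (Suc k) l \<union> (\<lambda>P. P @ [Right]) ` R \<union> (\<lambda>P. P @ [Up, Right]) ` D" for P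
    by (cases P rule: path_snoc_cases)
      (auto simp: Nil_in_corner_paths snoc_Up_in_corner_paths snoc_Right_in_corner_paths
        snoc_Up_Right_in_corner_paths R_def D_def image_iff split: nat.split)
  then have "corner_paths s c (Suc k) (Suc l) =
      (\<lambda>P. P @ [Up]) ` corner_paths s c (Suc k) l \<union> (\<lambda>P. P @ [Right]) ` R \<union> (\<lambda>P. P @ [Up, Right]) ` D"
    by blast
  also have "card \<dots> = card (corner_paths s c (Suc k) l) + card R + card D"
    using fin by (subst card_Un_disjoint card_Un_disjoint; (auto simp: R_def)[1])+
      (simp add: card_image inj_on_def)
  finally have 1: "card (corner_paths s c (Suc k) (Suc l)) =
      card (corner_paths s c (Suc k) l) + card R + card D" .
  \<comment> \<open>Splitting the paths to \<open>(k, Suc l)\<close> by their last step eliminates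
    \<open>R\<close>.\<close>
  have "P \<in> corner_paths s c k (Suc l) \<longleftrightarrow> P \<in> (\<lambda>P. P @ [Up]) ` corner_paths s c k l \<union> R" for P
    by (cases P rule: path_snoc_cases)
      (auto simp: Nil_in_corner_paths snoc_Up_in_corner_paths R_def image_iff)
  then have "corner_paths s c k (Suc l) = (\<lambda>P. P @ [Up]) ` corner_paths s c k l \<union> R"
    by blast
  also have "card \<dots> = card (corner_paths s c k l) + card R"
    using fin by (subst card_Un_disjoint) (auto simp: R_def card_image inj_on_def)
  finally have 2: "card (corner_paths s c k (Suc l)) = card (corner_paths s c k l) + card R" .
  show ?thesis using 1 2 by (auto simp: D_def split: nat.split)
qed

text \<open>Both sides satisfy the same mixed recurrence and agree when \<open>k\<close> or
  \<open>l\<close> is 0.\<close>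

lemma card_corner_paths: "card (corner_paths s c k l) = corner_chains s c k l"
proof (induction "k + l" arbitrary: c k l rule: less_induct)
  case less
  consider "k = 0" | "l = 0" | k' l' where "k = Suc k'" "l = Suc l'"
    by (metis not0_implies_Suc)
  then show ?case
  proof cases
    case 1
    then show ?thesis by (cases c) (auto simp: corner_paths_no_Right)
  next
    case 2
    then show ?thesis by (cases c) (auto simp: corner_paths_no_Up)
  next
    case 3
    have IH: "card (corner_paths s c' k' l') = corner_chains s c' k' l'"
      "card (corner_paths s c' k' (Suc l')) = corner_chains s c' k' (Suc l')"
      "card (corner_paths s c' (Suc k') l') = corner_chains s c' (Suc k') l'" for c'
      using 3 by (intro less; simp)+
    show ?thesis
    proof (cases c)
      case 0
      then show ?thesis
        using card_corner_paths_mixed_difference[of s c k' l'] 3 unfolding IH by simp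
    next
      case (Suc d)
      then show ?thesis
        using card_corner_paths_mixed_difference[of s c k' l'] 3 chains_mixed_difference[of s d k' l']
        unfolding IH by (simp del: corner_chains.simps)
    qed
  qed
qed

section \<open>Domination\<close>

definition periodic_ext :: "nat list \<Rightarrow> int \<Rightarrow> nat" where
  "periodic_ext a i = a ! nat (i mod int (length a))"

lemma boundary_of_nat:
  assumes "h \<le> length b" "b \<noteq> []"
  shows "boundary b (real h) = (\<Sum>j<h. real (b ! j))"
proof (cases "h < length b")
  case True
  then show ?thesis using boundary_eq[of h b "real h"] by simp
next
  case False
  \<comment> \<open>At the top height the last linear piece is evaluated at its upper end.\<close>
  moreover obtain r where "length b = Suc r" using assms(2) by (cases b) auto
  ultimately have "h = Suc r" "length b = Suc r" using assms(1) by auto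
  then show ?thesis using boundary_eq[of r b "real h"] by (simp add: add.commute)
qed

lemma point_dominated_cyclic_shift:
  assumes "a \<noteq> []" "0 \<le> y" "y \<le> int (length a)"
  shows "point_dominated (cyclic_shift a j) (x, y) \<longleftrightarrow>
    int (psum (periodic_ext a) (- int j) (nat y)) \<le> x"
proof -
  define h where "h = nat y"
  have y: "y = int h" and h: "h \<le> length a" using assms by (auto simp: h_def)
  have "boundary (cyclic_shift a j) (real h) = (\<Sum>i<h. real (cyclic_shift a j ! i))"
    using assms h by (intro boundary_of_nat) (auto simp: cyclic_shift_def)
  also have "\<dots> = real (psum (periodic_ext a) (- int j) h)"
    unfolding psum_def of_nat_sum using h
    by (intro sum.cong) (auto simp: cyclic_shift_def periodic_ext_def)
  finally have "boundary (cyclic_shift a j) (real h) = of_int (int (psum (periodic_ext a) (- int j) h))"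
    by simp
  then have "boundary (cyclic_shift a j) (real h) \<le> of_int x \<longleftrightarrow>
      int (psum (periodic_ext a) (- int j) h) \<le> x"
    by (metis of_int_le_iff)
  then show ?thesis using h
    by (simp add: y point_dominated_def) (simp add: cyclic_shift_def)
qed

text \<open>The boundary is monotone, so moving right or down from a dominated corner preserves
  domination. Height 0 is trivial, and the final vertical run is covered by the assumption on the
  end point.\<close>

lemma path_dominated_cyclic_shift:
  assumes "a \<noteq> []" "count_list P Up \<le> length a"
    and "psum (periodic_ext a) (- int j) (count_list P Up) \<le> count_list P Right"
  shows "path_dominated (cyclic_shift a j) P \<longleftrightarrow>
    (\<forall>q\<in>up_right_corners P. int (psum (periodic_ext a) (- int j) (nat (snd q))) \<le> fst q)"
proof -
  let ?s = "psum (periodic_ext a) (- int j)"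
  have dom: "point_dominated (cyclic_shift a j) p \<longleftrightarrow> int (?s (nat (snd p))) \<le> fst p"
    if "p \<in> path_points P" for p
    using path_points_bounds[OF that] assms point_dominated_cyclic_shift[of a "snd p" j "fst p"] by auto
  have "int (?s (nat (snd p))) \<le> fst p"
    if corners: "\<forall>q\<in>up_right_corners P. int (?s (nat (snd q))) \<le> fst q" and p: "p \<in> path_points P" for p
    using path_point_behind_corner[OF p]
  proof (elim disjE)
    assume "snd p = 0"
    then show ?thesis using path_points_bounds[OF p] by simp
  next
    assume "\<exists>q\<in>up_right_corners P. fst q \<le> fst p \<and> snd p \<le> snd q"
    then obtain q where q: "q \<in> up_right_corners P" "fst q \<le> fst p" "snd p \<le> snd q" by blast
    have "?s (nat (snd p)) \<le> ?s (nat (snd q))" using q by (intro monoD[OF mono_psum]) auto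
    then show ?thesis using corners q by fastforce
  next
    assume e: "P \<noteq> [] \<and> last P = Up \<and> fst p = int (count_list P Right)"
    have "?s (nat (snd p)) \<le> ?s (count_list P Up)"
      using path_points_bounds[OF p] by (intro monoD[OF mono_psum]) auto
    then show ?thesis using e assms(3) by simp
  qed
  then show ?thesis
    unfolding path_dominated_def using dom up_right_corners_subset by blast
qed

section \<open>Counting the good pairs\<close>

lemma card_good_lpbps:
  assumes "a \<noteq> []" "l \<le> length a" "\<And>j. psum (periodic_ext a) (- int j) l \<le> k"
  shows "card (good_lpbps (int k, int l) a \<inter> corner_lpbps (int c)) =
    (\<Sum>j<length a. corner_chains (psum (periodic_ext a) (- int j)) c k l)"
proof -
  let ?S = "\<lambda>j. corner_paths (psum (periodic_ext a) (- int j)) c k l"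
  have "good_lpbps (int k, int l) a \<inter> corner_lpbps (int c) =
      (\<lambda>(j, P). (P, (a, j))) ` (SIGMA j:{..<length a}. ?S j)"
  proof -
    have "(P, (b, j)) \<in> good_lpbps (int k, int l) a \<inter> corner_lpbps (int c) \<longleftrightarrow>
        b = a \<and> j < length a \<and> P \<in> ?S j" for P b j
      using assms path_dominated_cyclic_shift[of a P j]
      by (auto simp: good_lpbps_def corner_lpbps_def lpbps_def good_def corner_paths_def path_end_eq)
    then have "good_lpbps (int k, int l) a \<inter> corner_lpbps (int c) =
        {(P, (b, j)). b = a \<and> j < length a \<and> P \<in> ?S j}"
      by (intro set_eqI) (metis (mono_tags, lifting) case_prod_conv mem_Collect_eq surj_pair)
    then show ?thesis by auto
  qed
  also have "card \<dots> = card (SIGMA j:{..<length a}. ?S j)"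
    by (intro card_image) (auto simp: inj_on_def)
  also have "\<dots> = (\<Sum>j<length a. corner_chains (psum (periodic_ext a) (- int j)) c k l)"
    by (simp add: card_corner_paths)
  finally show ?thesis .
qed

lemma binom_of_nat: "binom (int k) (int c) = real (k choose c)"
  by (simp add: binom_def binomial_gbinomial)

theorem theorem2:
  fixes m n :: nat and a :: "nat list" and k l c :: int
  assumes "m > 0"
    and "weak_composition m n a"
    and "0 \<le> l" and "l \<le> int m"
    and "\<forall>j<m. point_dominated (cyclic_shift a j) (k, l)"
  shows "real (card (good_lpbps (k, l) a \<inter> corner_lpbps c)) =
    real m * binom k c * binom l c - real n * binom (k - 1) (c - 1) * binom (l + 1) (c + 1)"
proof (cases "c < 0")
  case True
  then have "corner_lpbps c = {}" by (auto simp: corner_lpbps_def)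
  then show ?thesis using True by (simp add: binom_def)
next
  case False
  have a: "length a = m" "sum_list a = n" "a \<noteq> []"
    using assms by (auto simp: weak_composition_def)
  let ?A = "periodic_ext a"
  have periodic: "?A (i mod int m) = ?A i" for i
    by (simp add: periodic_ext_def a)
  have n: "(\<Sum>r<m. ?A (int r)) = n"
    using a sum_list_sum_nth[of a] by (simp add: periodic_ext_def lessThan_atLeast0)
  have bound_int: "int (psum ?A b (nat l)) \<le> k" for b
  proof -
    \<comment> \<open>Each integer origin \<open>b\<close> is congruent modulo \<open>m\<close> to
      the origin \<open>- j\<close> of some shift.\<close>
    define j where "j = nat ((- b) mod int m)"
    have j: "j < m" and "(- int j) mod int m = b mod int m"
      using assms(1) by (auto simp: j_def nat_less_iff mod_minus_eq)
    then have "psum ?A (- int j) = psum ?A b"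
      by (metis psum_periodic[of ?A m, OF periodic])
    then show ?thesis
      using assms(3,4,5) j point_dominated_cyclic_shift[of a l j k] a by auto
  qed
  have "0 \<le> k" using bound_int[of 0] by linarith
  then obtain k' l' c' where nat_eq: "k = int k'" "l = int l'" "c = int c'"
    using assms(3) False by (metis nonneg_int_cases not_less)
  have bound: "psum ?A b l' \<le> k'" for b using bound_int[of b] nat_eq by simp
  have card: "card (good_lpbps (k, l) a \<inter> corner_lpbps c) =
      (\<Sum>j<m. corner_chains (psum ?A (- int j)) c' k' l')"
    using card_good_lpbps[of a l' k' c'] a bound assms(4) nat_eq by simp
  show ?thesis
  proof (cases c')
    case 0
    then show ?thesis unfolding card using nat_eq by (simp add: binom_def)
  next
    case (Suc e)
    have main: "(\<Sum>j<m. corner_chains (psum ?A (- int j)) c' k' l')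
        + n * ((k' - 1) choose e) * (Suc l' choose Suc (Suc e)) = m * (k' choose c') * (l' choose c')"
      using sum_chains_shifts[of m ?A l' k' e] assms(1) periodic bound n Suc by blast
    have "real n * binom (k - 1) (c - 1) * binom (l + 1) (c + 1) =
        real (n * ((k' - 1) choose e) * (Suc l' choose Suc (Suc e)))"
    \<comment> \<open>At \<open>k = 0\<close> the upper index is -1 on the left but truncated to 0
      on the right. If \<open>l > 0\<close>, domination forces every part of \<open>a\<close> to be
      0, so \<open>n = 0\<close>; if \<open>l = 0\<close>, the factor
      \<open>1 choose Suc (Suc e)\<close> vanishes.\<close>
    proof (cases "k' = 0 \<and> l' \<noteq> 0")
      case True
      have "?A b = 0" for b
        using bound[of b] True monoD[OF mono_psum, of "Suc 0" l' ?A b] by simp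
      then show ?thesis using n by auto
    next
      case False
      have l: "binom (l + 1) (c + 1) = real (Suc l' choose Suc (Suc e))"
        using binom_of_nat[of "Suc l'" "Suc c'"] nat_eq Suc by (simp add: add.commute)
      show ?thesis
      proof (cases "k' = 0")
        case True
        then show ?thesis using False l by simp
      next
        case False
        then have "binom (k - 1) (c - 1) = real ((k' - 1) choose e)"
          using binom_of_nat[of "k' - 1" e] nat_eq Suc by (simp add: of_nat_diff)
        then show ?thesis using l by simp
      qed
    qed
    moreover have "real (\<Sum>j<m. corner_chains (psum ?A (- int j)) c' k' l') +
        real (n * ((k' - 1) choose e) * (Suc l' choose Suc (Suc e))) = real m * binom k c * binom l c"
      using arg_cong[OF main, of real] unfolding nat_eq binom_of_nat of_nat_add of_nat_mult .
    ultimately show ?thesis unfolding card by linarith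
  qed
qed

end
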